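(* Let $T=(T_1,\ldots,T_n)\in\mathfrak{B}^n_0(\mathcal{H})$. If $X$ is a contraction on $\mathcal{H}$ with $XT_i=T_iX$ for all $i=1,\ldots,n$, then there exist positive operators $G_1,\ldots,G_n$ on $\mathcal{H}$ such that $$I-XX^*=G_1+\cdots+G_n\qquad\text{and}\qquad G_j-T_iG_jT_i^*=0\quad (i\neq j).$$
   Context: All Hilbert spaces are complex and separable; $n\ge 2$. "Positive" means positive semidefinite. A contraction $S$ is called pure if $S^{*k}\to 0$ in the strong operator topology as $k\to\infty$. The class $\mathfrak{B}^n_0(\mathcal{H})$ is the set of all $n$-tuples $T=(T_1,\ldots,T_n)$ of commuting contractions on $\mathcal{H}$ such that $I-T_iT_i^*-T_jT_j^*+T_iT_jT_i^*T_j^*=0$ for all $i\neq j$, and the product $T_1\cdots T_n$ is pure. *)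

theory Defs
  imports "HOL-Analysis.Analysis"
begin

text \<open>
  The norm, the metric and the real scalar multiplication are the ones of
  \<^class>\<open>real_normed_vector\<close>, tied to the complex structure by the axioms
  \<open>scaleR_scaleC\<close> and \<open>norm_eq_sqrt_cinner\<close>.
  The inner product is linear in its first argument.
\<close>

class complex_inner = real_normed_vector +
  fixes scaleC :: "complex \<Rightarrow> 'a \<Rightarrow> 'a" (infixr \<open>*\<^sub>C\<close> 75)
    and cinner :: "'a \<Rightarrow> 'a \<Rightarrow> complex"
  assumes scaleC_add_right: "c *\<^sub>C (x + y) = c *\<^sub>C x + c *\<^sub>C y"
    and scaleC_add_left: "(c + d) *\<^sub>C x = c *\<^sub>C x + d *\<^sub>C x"
    and scaleC_scaleC: "c *\<^sub>C (d *\<^sub>C x) = (c * d) *\<^sub>C x"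
    and scaleR_scaleC: "r *\<^sub>R x = complex_of_real r *\<^sub>C x"
    and cinner_add_left: "cinner (x + y) z = cinner x z + cinner y z"
    and cinner_scaleC_left: "cinner (c *\<^sub>C x) y = c * cinner x y"
    and cinner_commute: "cinner x y = cnj (cinner y x)"
    and cinner_nonneg: "cinner x x \<in> \<real>\<^sub>\<ge>\<^sub>0"
    and norm_eq_sqrt_cinner: "norm x = sqrt (Re (cinner x x))"

class chilbert_space = complex_inner + complete_space
begin

subclass banach ..

end

text \<open>
  The type \<open>'a \<Rightarrow>\<^sub>L 'b\<close> consists of the bounded real-linear maps; a bounded operator
  on a complex Hilbert space is an element of \<open>'a \<Rightarrow>\<^sub>L 'a\<close> that is in addition
  complex-homogeneous. Its norm is the usual operator norm.
\<close>

definition complex_linear :: "('a::complex_inner \<Rightarrow>\<^sub>L 'a) \<Rightarrow> bool" where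
  "complex_linear A \<longleftrightarrow> (\<forall>c x. A (c *\<^sub>C x) = c *\<^sub>C A x)"

text \<open>
  On a \<^class>\<open>chilbert_space\<close>, every complex-linear bounded operator has exactly one
  adjoint by the Riesz representation theorem; the definition is only used for such operators.
\<close>

definition cadjoint :: "('a::complex_inner \<Rightarrow>\<^sub>L 'a) \<Rightarrow> ('a \<Rightarrow>\<^sub>L 'a)"
  (\<open>_\<^sup>\<star>\<close> [1000] 1000) where
  "A\<^sup>\<star> = (THE B :: 'a \<Rightarrow>\<^sub>L 'a. \<forall>x y. cinner (A x) y = cinner x (B y))"

definition positive_operator :: "('a::complex_inner \<Rightarrow>\<^sub>L 'a) \<Rightarrow> bool" where
  "positive_operator A \<longleftrightarrow> complex_linear A \<and> (\<forall>x. cinner (A x) x \<in> \<real>\<^sub>\<ge>\<^sub>0)"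

definition contraction :: "('a::complex_inner \<Rightarrow>\<^sub>L 'a) \<Rightarrow> bool" where
  "contraction A \<longleftrightarrow> complex_linear A \<and> norm A \<le> 1"

primrec blinfun_power :: "('a::real_normed_vector \<Rightarrow>\<^sub>L 'a) \<Rightarrow> nat \<Rightarrow> ('a \<Rightarrow>\<^sub>L 'a)" where
  "blinfun_power A 0 = id_blinfun"
| "blinfun_power A (Suc k) = A o\<^sub>L blinfun_power A k"

definition pure_contraction :: "('a::complex_inner \<Rightarrow>\<^sub>L 'a) \<Rightarrow> bool" where
  "pure_contraction S \<longleftrightarrow> contraction S \<and>
     limitin strong_operator_topology (\<lambda>k. blinfun_power (S\<^sup>\<star>) k) 0 sequentially"

text \<open>
  An \<open>n\<close>-tuple is a function on \<^typ>\<open>nat\<close> of which only the values at \<open>1, \<dots>, n\<close> are used;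
  \<open>tuple_product n T\<close> is \<open>T\<^sub>1 \<cdots> T\<^sub>n\<close>.
\<close>

primrec tuple_product :: "nat \<Rightarrow> (nat \<Rightarrow> 'a::real_normed_vector \<Rightarrow>\<^sub>L 'a) \<Rightarrow> ('a \<Rightarrow>\<^sub>L 'a)" where
  "tuple_product 0 T = id_blinfun"
| "tuple_product (Suc n) T = tuple_product n T o\<^sub>L T (Suc n)"

definition class_B0 :: "nat \<Rightarrow> (nat \<Rightarrow> 'a::complex_inner \<Rightarrow>\<^sub>L 'a) set" where
  "class_B0 n = {T.
     (\<forall>i\<in>{1..n}. contraction (T i)) \<and>
     (\<forall>i\<in>{1..n}. \<forall>j\<in>{1..n}. T i o\<^sub>L T j = T j o\<^sub>L T i) \<and>
     (\<forall>i\<in>{1..n}. \<forall>j\<in>{1..n}. i \<noteq> j \<longrightarrow>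
        id_blinfun - (T i o\<^sub>L (T i)\<^sup>\<star>) - (T j o\<^sub>L (T j)\<^sup>\<star>)
          + (T i o\<^sub>L T j o\<^sub>L (T i)\<^sup>\<star> o\<^sub>L (T j)\<^sup>\<star>) = 0) \<and>
     pure_contraction (tuple_product n T)}"

end

theory Submission
  imports Defs
begin

text \<open>
  Put \<open>S\<^sub>i = T\<^sub>i\<^sup>\<star>\<close> and \<open>q x = \<parallel>x\<parallel>\<^sup>2 - \<parallel>X\<^sup>\<star> x\<parallel>\<^sup>2\<close>, the quadratic form of \<open>\<Delta> = I - X X\<^sup>\<star>\<close>.
  Since \<open>X\<close> commutes with the \<open>T\<^sub>i\<close>, the form \<open>q\<close> inherits from the tuple the relation
  \<open>q - q \<circ> S\<^sub>i - q \<circ> S\<^sub>j + q \<circ> S\<^sub>i \<circ> S\<^sub>j = 0\<close> for \<open>i \<noteq> j\<close>. In other words the drop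
  \<open>q - q \<circ> S\<^sub>j\<^sup>k\<close> is invariant under every \<open>S\<^sub>i\<close> with \<open>i \<noteq> j\<close>, so that the drops along
  \<open>S\<^sub>1\<^sup>k, \<dots>, S\<^sub>n\<^sup>k\<close> add up to the drop along the \<open>k\<close>-th power of \<open>(T\<^sub>1 \<cdots> T\<^sub>n)\<^sup>\<star>\<close>. By purity the
  latter tends to \<open>q\<close>. Hence \<open>G\<^sub>j\<close> is the operator whose form is the limit of the \<open>j\<close>-th drop; it
  exists because \<open>T\<^sub>j\<^sup>k S\<^sub>j\<^sup>k\<close> is decreasing in \<open>k\<close>, hence weakly convergent.
\<close>

section \<open>Complex inner product spaces\<close>

lemma cinner_add_right: "cinner x (y + z) = cinner x y + cinner x (z::'a::complex_inner)"
  by (metis cinner_add_left cinner_commute complex_cnj_add)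

lemma cinner_scaleC_right: "cinner x (c *\<^sub>C y) = cnj c * cinner x (y::'a::complex_inner)"
  by (metis cinner_commute cinner_scaleC_left complex_cnj_mult)

lemma cinner_scaleR_left: "cinner (r *\<^sub>R x) y = of_real r * cinner x (y::'a::complex_inner)"
  by (simp add: scaleR_scaleC cinner_scaleC_left)

lemma cinner_scaleR_right: "cinner x (r *\<^sub>R y) = of_real r * cinner x (y::'a::complex_inner)"
  by (simp add: scaleR_scaleC cinner_scaleC_right)

lemma cinner_zero_left [simp]: "cinner 0 (y::'a::complex_inner) = 0"
  using cinner_scaleR_left[of 0 0 y] by simp

lemma cinner_minus_left: "cinner (- x) y = - cinner x (y::'a::complex_inner)"
  using cinner_scaleR_left[of "-1" x y] by simp

lemma cinner_diff_left: "cinner (x - z) y = cinner x y - cinner z (y::'a::complex_inner)"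
  using cinner_add_left[of x "-z" y] by (simp add: cinner_minus_left)

lemma cinner_minus_right: "cinner x (- y) = - cinner x (y::'a::complex_inner)"
  using cinner_scaleR_right[of x "-1" y] by simp

lemma cinner_diff_right: "cinner x (y - z) = cinner x y - cinner x (z::'a::complex_inner)"
  using cinner_add_right[of x y "-z"] by (simp add: cinner_minus_right)

lemma cinner_sum_left: "cinner (\<Sum>i\<in>I. f i) y = (\<Sum>i\<in>I. cinner (f i) (y::'a::complex_inner))"
  by (induction I rule: infinite_finite_induct) (simp_all add: cinner_add_left)

lemma cinner_self: "cinner x x = of_real ((norm (x::'a::complex_inner))\<^sup>2)"
proof -
  have "Im (cinner x x) = 0" "Re (cinner x x) \<ge> 0"
    using cinner_nonneg[of x] by (auto simp: complex_nonneg_Reals_iff)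
  then show ?thesis
    by (simp add: norm_eq_sqrt_cinner complex_eq_iff)
qed

lemma norm_add_power2:
  "(norm (x + y))\<^sup>2 = (norm x)\<^sup>2 + 2 * Re (cinner x y) + (norm (y::'a::complex_inner))\<^sup>2"
proof -
  have "Re (cinner y x) = Re (cinner x y)"
    by (subst cinner_commute) simp
  then have "Re (cinner (x + y) (x + y)) = Re (cinner x x) + 2 * Re (cinner x y) + Re (cinner y y)"
    by (simp add: cinner_add_left cinner_add_right del: Re_complex_of_real)
  then show ?thesis
    by (simp only: cinner_self Re_complex_of_real)
qed

lemma norm_diff_power2:
  "(norm (x - y))\<^sup>2 = (norm x)\<^sup>2 - 2 * Re (cinner x y) + (norm (y::'a::complex_inner))\<^sup>2"
  using norm_add_power2[of x "-y"] by (simp add: cinner_minus_right)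

lemma norm_scaleC: "norm (c *\<^sub>C x) = cmod c * norm (x::'a::complex_inner)"
proof -
  have "complex_of_real ((norm (c *\<^sub>C x))\<^sup>2) = c * cnj c * cinner x x"
    by (simp only: cinner_scaleC_left cinner_scaleC_right ac_simps flip: cinner_self)
  also have "\<dots> = of_real ((cmod c * norm x)\<^sup>2)"
    by (simp only: cinner_self power_mult_distrib of_real_mult complex_norm_square)
  finally show ?thesis
    by (simp only: of_real_eq_iff power2_eq_iff_nonneg norm_ge_zero mult_nonneg_nonneg)
qed

text \<open>In the class \<^class>\<open>complex_inner\<close> the triangle inequality is an axiom; Cauchy-Schwarz
  follows from it.\<close>

lemma Re_cinner_le: "Re (cinner x y) \<le> norm x * norm (y::'a::complex_inner)"
proof -
  have "(norm (x + y))\<^sup>2 \<le> (norm x + norm y)\<^sup>2"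
    by (intro power_mono norm_triangle_ineq norm_ge_zero)
  then show ?thesis
    by (simp add: norm_add_power2) (simp add: power2_sum)
qed

lemma cmod_cinner_le: "cmod (cinner x y) \<le> norm x * norm (y::'a::complex_inner)"
proof (cases "cinner x y = 0")
  case False
  \<comment> \<open>This unimodular factor rotates \<open>x\<close> so that the inner product
    becomes its own modulus; the real bound then applies.\<close>
  define c where "c = cnj (sgn (cinner x y))"
  have "c * cinner x y = of_real (cmod (cinner x y))"
    using False by (simp add: c_def sgn_div_norm scaleR_conv_of_real field_simps power2_eq_square
        complex_norm_square[symmetric] flip: of_real_power)
  moreover have "cmod c = 1"
    using False by (simp add: c_def norm_sgn)
  ultimately show ?thesis
    using Re_cinner_le[of "c *\<^sub>C x" y] by (simp add: cinner_scaleC_left norm_scaleC)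
qed simp

lemma cinner_eqI_right: "(\<And>x. cinner x y = cinner x z) \<Longrightarrow> y = (z::'a::complex_inner)"
  using cinner_self[of "y - z"] by (simp add: cinner_diff_right)

text \<open>Reduces convergence of inner products to convergence of squared norms, one real
  component at a time.\<close>

lemma cinner_polarization:
  "cinner x y = Complex (((norm (x + y))\<^sup>2 - (norm (x - y))\<^sup>2) / 4)
     (((norm (x + \<i> *\<^sub>C y))\<^sup>2 - (norm (x - \<i> *\<^sub>C (y::'a::complex_inner)))\<^sup>2) / 4)"
  by (simp add: complex_eq_iff norm_add_power2 norm_diff_power2 cinner_scaleC_right)

section \<open>The Riesz representation theorem\<close>

text \<open>The representing vector is the minimizer of \<open>\<parallel>x\<parallel>\<^sup>2 - 2 g x\<close>; a minimizing sequence
  is Cauchy by the parallelogram law.\<close>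

lemma Riesz_real:
  fixes g :: "'a::chilbert_space \<Rightarrow> real"
  assumes "bounded_linear g"
  shows "\<exists>u. \<forall>x. g x = Re (cinner x u)"
proof -
  interpret g: bounded_linear g by fact
  obtain C where C: "\<And>x. norm (g x) \<le> norm x * C"
    using g.bounded by blast
  define J where "J x = (norm x)\<^sup>2 - 2 * g x" for x
  have J_lower: "- C\<^sup>2 \<le> J x" for x
  proof -
    have "0 \<le> (norm x - C)\<^sup>2" by simp
    with C[of x] show ?thesis
      by (simp add: J_def power2_diff)
  qed
  then have bdd: "bdd_below (range J)"
    by (intro bdd_belowI[of _ "- C\<^sup>2"]) auto
  define m where "m = Inf (range J)"
  have m_le: "m \<le> J x" for x
    unfolding m_def by (intro cInf_lower bdd) simp
  have "\<exists>x. J x < m + inverse (real (Suc k))" for k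
  proof -
    have "m < m + inverse (real (Suc k))" by simp
    then show ?thesis
      unfolding m_def by (subst (asm) cInf_less_iff) (use bdd in auto)
  qed
  then obtain u where u: "\<And>k. J (u k) < m + inverse (real (Suc k))"
    by metis
  have dist_u: "(norm (u k - u l))\<^sup>2 \<le> 2 * inverse (real (Suc k)) + 2 * inverse (real (Suc l))" for k l
  proof -
    \<comment> \<open>Parallelogram law at the midpoint: the terms with \<open>g\<close> cancel by
      linearity, and \<open>m \<le> J\<close> there absorbs the infimum.\<close>
    have "(norm (u k - u l))\<^sup>2 = 2 * J (u k) + 2 * J (u l) - 4 * J ((1/2) *\<^sub>R (u k + u l))"
      by (simp add: J_def norm_diff_power2 norm_add_power2 g.add g.scaleR
          cinner_scaleR_left cinner_scaleR_right power_divide field_simps)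
    with u[of k] u[of l] m_le[of "(1/2) *\<^sub>R (u k + u l)"] show ?thesis by argo
  qed
  have "Cauchy u"
  proof (rule metric_CauchyI)
    fix e :: real assume "e > 0"
    then have "e\<^sup>2 / 4 > 0" by simp
    then obtain N where N: "inverse (real (Suc N)) < e\<^sup>2 / 4"
      using reals_Archimedean by blast
    show "\<exists>M. \<forall>k\<ge>M. \<forall>l\<ge>M. dist (u k) (u l) < e"
    proof (intro exI[of _ N] allI impI)
      fix k l assume "N \<le> k" "N \<le> l"
      then have "inverse (real (Suc k)) \<le> inverse (real (Suc N))"
        "inverse (real (Suc l)) \<le> inverse (real (Suc N))"
        by (simp_all add: le_imp_inverse_le)
      with dist_u[of k l] N have "(norm (u k - u l))\<^sup>2 < e\<^sup>2" by argo
      with \<open>e > 0\<close> show "dist (u k) (u l) < e"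
        by (simp add: dist_norm power2_less_imp_less)
    qed
  qed
  then obtain v where v: "u \<longlonglongrightarrow> v"
    using Cauchy_convergent_iff convergent_def by blast
  have "(\<lambda>k. J (u k)) \<longlonglongrightarrow> J v"
    unfolding J_def by (intro tendsto_intros v g.tendsto)
  moreover have "(\<lambda>k. m + inverse (real (Suc k))) \<longlonglongrightarrow> m + 0"
    by (intro tendsto_intros LIMSEQ_inverse_real_of_nat)
  ultimately have "J v \<le> m + 0"
    using u less_imp_le by (intro LIMSEQ_le) auto
  with m_le have J_min: "J v \<le> J x" for x
    by (metis add_0_right order_trans)
  have "g y = Re (cinner v y)" for y
  proof (rule ccontr)
    \<comment> \<open>The slope of \<open>J\<close> at \<open>v\<close> along \<open>y\<close> is
      \<open>2 * a\<close>, so a move by \<open>- a * s\<close> lowers \<open>J\<close> once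
      \<open>s * (norm y)\<^sup>2 < 2\<close>. The summand 1 in \<open>s\<close> covers
      \<open>y = 0\<close>.\<close>
    define a where "a = Re (cinner v y) - g y"
    define s where "s = inverse ((norm y)\<^sup>2 + 1)"
    assume "g y \<noteq> Re (cinner v y)"
    then have "a\<^sup>2 > 0" by (simp add: a_def)
    have pos: "(norm y)\<^sup>2 + 1 > 0"
      by (simp add: add_nonneg_pos)
    then have "s > 0" and s1: "s * (norm y)\<^sup>2 < 1"
      by (simp_all add: s_def field_simps)
    have "J (v + (- a * s) *\<^sub>R y) = J v + (a\<^sup>2 * s) * (s * (norm y)\<^sup>2 - 2)"
      by (simp add: J_def norm_diff_power2 cinner_scaleR_right g.diff g.scaleR power_mult_distrib)
         (simp add: a_def algebra_simps power2_eq_square)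
    moreover have "(a\<^sup>2 * s) * (s * (norm y)\<^sup>2 - 2) < 0"
      using \<open>a\<^sup>2 > 0\<close> \<open>s > 0\<close> s1 by (intro mult_pos_neg mult_pos_pos) auto
    ultimately show False
      using J_min[of "v + (- a * s) *\<^sub>R y"] by simp
  qed
  then show ?thesis
    by (metis cinner_commute cnj.simps(1))
qed

text \<open>Riesz is applied to the real part of \<open>\<phi>\<close> in its first argument; the
  imaginary part at \<open>x\<close> is read off from the real part at
  \<open>\<i> *\<^sub>C x\<close>. Uniqueness of the representing vector makes it linear in
  \<open>y\<close>.\<close>

lemma sesquilinear_representation:
  fixes \<phi> :: "'a::chilbert_space \<Rightarrow> 'a \<Rightarrow> complex"
  assumes add_left: "\<And>x y z. \<phi> (x + y) z = \<phi> x z + \<phi> y z"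
    and scale_left: "\<And>c x z. \<phi> (c *\<^sub>C x) z = c * \<phi> x z"
    and add_right: "\<And>x y z. \<phi> x (y + z) = \<phi> x y + \<phi> x z"
    and scale_right: "\<And>c x z. \<phi> x (c *\<^sub>C z) = cnj c * \<phi> x z"
    and bound: "\<And>x y. cmod (\<phi> x y) \<le> C * norm x * norm y"
  shows "\<exists>B. complex_linear B \<and> (\<forall>x y. \<phi> x y = cinner x (blinfun_apply B y))"
proof -
  have "\<exists>u. \<forall>x. Re (\<phi> x y) = Re (cinner x u)" for y
  proof (rule Riesz_real, rule bounded_linear_intro)
    show "norm (Re (\<phi> x y)) \<le> norm x * (C * norm y)" for x
      using bound[of x y] abs_Re_le_cmod[of "\<phi> x y"] by (simp add: ac_simps)
  qed (simp_all add: add_left scaleR_scaleC scale_left)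
  then obtain b where Re_b: "\<And>x y. Re (\<phi> x y) = Re (cinner x (b y))"
    by metis
  have b: "\<phi> x y = cinner x (b y)" for x y
    using Re_b[of x y] Re_b[of "\<i> *\<^sub>C x" y]
    by (simp add: complex_eq_iff scale_left cinner_scaleC_left)
  have b_add: "b (x + y) = b x + b y" for x y
    by (rule cinner_eqI_right) (simp add: cinner_add_right add_right flip: b)
  have b_scale: "b (c *\<^sub>C x) = c *\<^sub>C b x" for c x
    by (rule cinner_eqI_right) (simp add: cinner_scaleC_right scale_right flip: b)
  have "norm (b y) \<le> norm y * C" for y
  proof (cases "b y = 0")
    case True
    \<comment> \<open>The sign of \<open>C\<close> comes from the bound itself, taken at a nonzero
      \<open>y\<close>.\<close>
    have "0 \<le> C * norm y"
      if "y \<noteq> 0"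
      using order_trans[OF norm_ge_zero bound[of y y]] that
      by (simp add: zero_le_mult_iff)
    then show ?thesis using True by (cases "y = 0") (simp_all add: mult.commute)
  next
    case False
    \<comment> \<open>Testing the bound at \<open>x = b y\<close> produces the square of the norm to
      be estimated.\<close>
    have "norm (b y) * norm (b y) \<le> norm (b y) * (C * norm y)"
      using bound[of "b y" y] by (simp add: b cinner_self power2_eq_square norm_mult ac_simps)
    with False show ?thesis by (simp add: mult.commute)
  qed
  then have "bounded_linear b"
    by (intro bounded_linear_intro b_add) (auto simp: scaleR_scaleC b_scale)
  then show ?thesis
    by (intro exI[of _ "Blinfun b"])
       (simp add: complex_linear_def bounded_linear_Blinfun_apply b_scale b)
qed

section \<open>Adjoints\<close>

text \<open>Nondegeneracy of the inner product gives the uniqueness that the definite description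
  asks for.\<close>

lemma cadjoint_eqI:
  fixes A B :: "'a::complex_inner \<Rightarrow>\<^sub>L 'a"
  assumes "\<And>x y. cinner (A x) y = cinner x (B y)"
  shows "A\<^sup>\<star> = B"
  unfolding cadjoint_def
proof (rule the_equality)
  show "B' = B" if "\<forall>x y. cinner (A x) y = cinner x (blinfun_apply B' y)" for B'
    using that assms by (intro blinfun_eqI cinner_eqI_right) metis
qed (use assms in blast)

context
  fixes A :: "'a::chilbert_space \<Rightarrow>\<^sub>L 'a"
  assumes A: "complex_linear A"
begin

text \<open>Existence of the adjoint: by Cauchy-Schwarz the form \<open>cinner (A x) y\<close> is
  bounded, hence represented by an operator.\<close>

lemma complex_linear_cadjoint: "complex_linear (A\<^sup>\<star>)"
  and cinner_cadjoint_right: "cinner x (A\<^sup>\<star> y) = cinner (A x) y"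
proof -
  have bound: "cmod (cinner (A x) y) \<le> norm A * norm x * norm y" for x y
    by (rule order_trans[OF cmod_cinner_le]) (simp add: mult_right_mono norm_blinfun)
  have "\<exists>B. complex_linear B \<and> (\<forall>x y. cinner (A x) y = cinner x (blinfun_apply B y))"
    using A by (intro sesquilinear_representation[OF _ _ _ _ bound])
      (auto simp: complex_linear_def blinfun.add_right cinner_add_left cinner_add_right
        cinner_scaleC_left cinner_scaleC_right)
  then obtain B where "complex_linear B" "\<And>x y. cinner (A x) y = cinner x (blinfun_apply B y)"
    by blast
  moreover from this have "A\<^sup>\<star> = B"
    by (intro cadjoint_eqI)
  ultimately show "complex_linear (A\<^sup>\<star>)" "cinner x (A\<^sup>\<star> y) = cinner (A x) y" by auto
qed

end

lemma cadjoint_compose: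
  fixes A B :: "'a::chilbert_space \<Rightarrow>\<^sub>L 'a"
  assumes "complex_linear A" "complex_linear B"
  shows "(A o\<^sub>L B)\<^sup>\<star> = B\<^sup>\<star> o\<^sub>L A\<^sup>\<star>"
  using assms by (intro cadjoint_eqI) (simp add: cinner_cadjoint_right)

lemma norm_cadjoint_apply_le:
  fixes A :: "'a::chilbert_space \<Rightarrow>\<^sub>L 'a"
  assumes "contraction A"
  shows "norm (A\<^sup>\<star> x) \<le> norm x"
proof -
  have A: "complex_linear A" "norm A \<le> 1"
    using assms by (auto simp: contraction_def)
  have "(norm (A\<^sup>\<star> x))\<^sup>2 = cmod (cinner (A (A\<^sup>\<star> x)) x)"
    using cinner_cadjoint_right[OF A(1), of "A\<^sup>\<star> x" x]
    by (simp add: cinner_self norm_power flip: cinner_cadjoint_right[OF A(1)])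
  also have "\<dots> \<le> norm (A (A\<^sup>\<star> x)) * norm x"
    by (rule cmod_cinner_le)
  also have "norm (A (A\<^sup>\<star> x)) \<le> 1 * norm (A\<^sup>\<star> x)"
    by (rule order_trans[OF norm_blinfun]) (intro mult_right_mono A norm_ge_zero)
  finally show ?thesis
    by (cases "A\<^sup>\<star> x = 0") (simp_all add: power2_eq_square mult_right_mono)
qed

text \<open>Lets operator identities be checked on quadratic forms. If the form of \<open>D\<close>
  vanishes, then \<open>cinner (D u) v + cinner (D v) u = 0\<close>; with
  \<open>\<i> *\<^sub>C v\<close> for \<open>v\<close> the two terms acquire opposite factors, so
  each is zero.\<close>

lemma complex_linear_eqI:
  fixes A B :: "'a::complex_inner \<Rightarrow>\<^sub>L 'a"
  assumes "complex_linear A" "complex_linear B"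
    and eq: "\<And>x. cinner (A x) x = cinner (B x) x"
  shows "A = B"
proof (rule blinfun_eqI)
  fix x
  define D where "D = A - B"
  have D_scale: "D (c *\<^sub>C u) = c *\<^sub>C D u" for c u
    using assms(1,2) scaleC_add_right[of c "A u - B u" "B u"]
    by (simp add: D_def complex_linear_def blinfun.diff_left algebra_simps)
  have D0: "cinner (D u) u = 0" for u
    by (simp add: D_def blinfun.diff_left cinner_diff_left eq)
  have 1: "cinner (D u) v + cinner (D v) u = 0" for u v
    using D0[of "u + v"] by (simp add: blinfun.add_right cinner_add_left cinner_add_right D0 add.commute)
  have "cinner (D u) v = 0" for u v
    using 1[of u v] 1[of u "\<i> *\<^sub>C v"]
    by (simp add: D_scale cinner_scaleC_left cinner_scaleC_right)
  from this[of x "D x"] show "A x = B x"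
    by (simp add: cinner_self D_def blinfun.diff_left)
qed

lemma complex_linear_compose: "complex_linear A \<Longrightarrow> complex_linear B \<Longrightarrow> complex_linear (A o\<^sub>L B)"
  by (simp add: complex_linear_def)

lemma complex_linear_diff: "complex_linear A \<Longrightarrow> complex_linear B \<Longrightarrow> complex_linear (A - B)"
  by (simp add: complex_linear_def blinfun.diff_left)
     (metis add_diff_cancel_right' diff_add_cancel scaleC_add_right)

lemma complex_linear_id: "complex_linear id_blinfun"
  by (simp add: complex_linear_def)

lemma complex_linear_zero: "complex_linear (0 :: 'a::complex_inner \<Rightarrow>\<^sub>L 'a)"
  using complex_linear_diff[OF complex_linear_id complex_linear_id] by simp

lemma complex_linear_sum:
  "(\<And>i. i \<in> I \<Longrightarrow> complex_linear (A i)) \<Longrightarrow> complex_linear (\<Sum>i\<in>I. A i)"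
  by (induction I rule: infinite_finite_induct)
     (simp_all add: complex_linear_zero, simp add: complex_linear_def blinfun.add_left scaleC_add_right)

text \<open>The squared norms of the iterates decrease, hence converge; by polarization so do the
  inner products of iterates. Their limit is a bounded sesquilinear form, and \<open>A\<close>
  represents it: the weak limit of the \<open>k\<close>-th power of the adjoint of \<open>S\<close>
  times the \<open>k\<close>-th power of \<open>S\<close>.\<close>

lemma limit_norm_power_operator:
  fixes S :: "'a::chilbert_space \<Rightarrow>\<^sub>L 'a"
  assumes S: "complex_linear S" and S_le: "\<And>x. norm (S x) \<le> norm x"
  shows "\<exists>A. complex_linear A \<and>
    (\<forall>x. \<exists>r. cinner (blinfun_apply A x) x = of_real r \<and>
       (\<lambda>k. (norm ((blinfun_apply S ^^ k) x))\<^sup>2) \<longlonglongrightarrow> r)"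
proof -
  let ?S = "\<lambda>k. blinfun_apply S ^^ k"
  have add: "?S k (x + y) = ?S k x + ?S k y" for k x y
    by (induction k) (simp_all add: blinfun.add_right)
  have diff: "?S k (x - y) = ?S k x - ?S k y" for k x y
    by (induction k) (simp_all add: blinfun.diff_right)
  have scale: "?S k (c *\<^sub>C x) = c *\<^sub>C ?S k x" for k c x
    using S by (induction k) (simp_all add: complex_linear_def)
  have le: "norm (?S k x) \<le> norm x" for k x
    by (induction k) (auto intro: order_trans[OF S_le])
  have conv: "convergent (\<lambda>k. (norm (?S k x))\<^sup>2)" for x
  proof (rule Bseq_monoseq_convergent)
    show "Bseq (\<lambda>k. (norm (?S k x))\<^sup>2)"
      by (rule BseqI'[where K = "(norm x)\<^sup>2"]) (simp add: le power_mono)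
    show "monoseq (\<lambda>k. (norm (?S k x))\<^sup>2)"
      by (rule decseq_imp_monoseq, rule decseq_SucI) (simp add: S_le power_mono)
  qed
  have "convergent (\<lambda>k. cinner (?S k x) (?S k y))" for x y
  proof -
    have scaled: "convergent (\<lambda>k. (norm (?S k x + c *\<^sub>C ?S k y))\<^sup>2)"
      "convergent (\<lambda>k. (norm (?S k x - c *\<^sub>C ?S k y))\<^sup>2)" for c
      using conv[of "x + c *\<^sub>C y"] conv[of "x - c *\<^sub>C y"] by (simp_all add: add diff scale)
    have unscaled: "convergent (\<lambda>k. (norm (?S k x + ?S k y))\<^sup>2)"
      "convergent (\<lambda>k. (norm (?S k x - ?S k y))\<^sup>2)"
      using conv[of "x + y"] conv[of "x - y"] by (simp_all add: add diff)
    have "convergent (\<lambda>k. Complex (f k / 4) (g k / 4))"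
      if "convergent f" "convergent g" for f g :: "nat \<Rightarrow> real"
    proof -
      have "(\<lambda>k. Complex (f k / 4) (g k / 4)) \<longlonglongrightarrow> Complex (lim f / 4) (lim g / 4)"
        using that unfolding convergent_LIMSEQ_iff by (intro tendsto_intros) simp_all
      then show ?thesis by (rule convergentI)
    qed
    then show ?thesis
      unfolding cinner_polarization[of "?S _ x"]
      using convergent_diff[OF unscaled] convergent_diff[OF scaled] by blast
  qed
  then obtain \<phi> where \<phi>: "\<And>x y. (\<lambda>k. cinner (?S k x) (?S k y)) \<longlonglongrightarrow> \<phi> x y"
    unfolding convergent_def by metis
  have "\<exists>B. complex_linear B \<and> (\<forall>x y. \<phi> x y = cinner x (blinfun_apply B y))"
  proof (rule sesquilinear_representation)
    show "\<phi> (x + y) z = \<phi> x z + \<phi> y z" for x y z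
      by (rule LIMSEQ_unique[OF \<phi>]) (simp add: add cinner_add_left tendsto_add \<phi>)
    show "\<phi> (c *\<^sub>C x) z = c * \<phi> x z" for c x z
      by (rule LIMSEQ_unique[OF \<phi>]) (simp add: scale cinner_scaleC_left tendsto_mult_left \<phi>)
    show "\<phi> x (y + z) = \<phi> x y + \<phi> x z" for x y z
      by (rule LIMSEQ_unique[OF \<phi>]) (simp add: add cinner_add_right tendsto_add \<phi>)
    show "\<phi> x (c *\<^sub>C z) = cnj c * \<phi> x z" for c x z
      by (rule LIMSEQ_unique[OF \<phi>]) (simp add: scale cinner_scaleC_right tendsto_mult_left \<phi>)
    show "cmod (\<phi> x y) \<le> 1 * norm x * norm y" for x y
    proof (rule LIMSEQ_le_const2[OF tendsto_norm[OF \<phi>]], intro exI allI impI)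
      fix k
      show "norm (cinner (?S k x) (?S k y)) \<le> 1 * norm x * norm y"
        using order_trans[OF cmod_cinner_le mult_mono[OF le le]] by simp
    qed
  qed
  then obtain B where B: "complex_linear B" "\<And>x y. \<phi> x y = cinner x (blinfun_apply B y)"
    by blast
  have "cinner (B x) x = of_real (Re (\<phi> x x)) \<and> (\<lambda>k. (norm (?S k x))\<^sup>2) \<longlonglongrightarrow> Re (\<phi> x x)" for x
  proof -
    have "(\<lambda>k. complex_of_real ((norm (?S k x))\<^sup>2)) \<longlonglongrightarrow> \<phi> x x"
      using \<phi>[of x x] by (simp add: cinner_self)
    moreover from this have "(\<lambda>k. (norm (?S k x))\<^sup>2) \<longlonglongrightarrow> Re (\<phi> x x)"
      using tendsto_Re by fastforce
    ultimately have "\<phi> x x = of_real (Re (\<phi> x x))"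
      using LIMSEQ_unique tendsto_of_real by blast
    \<comment> \<open>\<open>B\<close> represents \<open>\<phi>\<close> in the second argument;
      since the value is real, conjugation moves it to the first.\<close>
    then have "cinner (B x) x = of_real (Re (\<phi> x x))"
      by (metis B(2) cinner_commute complex_cnj_complex_of_real)
    with \<open>_ \<longlonglongrightarrow> Re (\<phi> x x)\<close> show ?thesis by blast
  qed
  with B(1) show ?thesis by blast
qed

section \<open>Commuting self-maps with vanishing defects\<close>

lemma funpow_commute:
  assumes "\<And>x. f (g x) = g (f x)"
  shows "(f ^^ k) (g x) = g ((f ^^ k) x)"
  by (induction k) (simp_all add: assms)

text \<open>The algebraic core, free of linear structure: the maps will be the adjoints of the
  \<open>T i\<close>, and \<open>q\<close> the form of the defect of \<open>X\<close>.\<close>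

locale vanishing_defects =
  fixes n :: nat and S :: "nat \<Rightarrow> 'a \<Rightarrow> 'a" and q :: "'a \<Rightarrow> real"
  assumes commute: "\<And>i j x. i \<in> {1..n} \<Longrightarrow> j \<in> {1..n} \<Longrightarrow> S i (S j x) = S j (S i x)"
    and defect: "\<And>i j x. i \<in> {1..n} \<Longrightarrow> j \<in> {1..n} \<Longrightarrow> i \<noteq> j \<Longrightarrow>
      q x - q (S i x) - q (S j x) + q (S i (S j x)) = 0"
begin

lemma power_commute:
  assumes "i \<in> {1..n}" "j \<in> {1..n}"
  shows "(S i ^^ k) ((S j ^^ l) x) = (S j ^^ l) ((S i ^^ k) x)"
  using assms by (intro funpow_commute) (metis commute funpow_commute)

text \<open>The vanishing defect says that a single drop along \<open>S j\<close> is the same at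
  \<open>y\<close> and at \<open>S i y\<close>; a drop along a power telescopes into single
  drops.\<close>

lemma drop_invariant:
  assumes "i \<in> {1..n}" "j \<in> {1..n}" "i \<noteq> j"
  shows "q (S i x) - q ((S j ^^ k) (S i x)) = q x - q ((S j ^^ k) x)"
proof (induction k)
  case (Suc k)
  have "q ((S j ^^ k) x) - q (S i ((S j ^^ k) x)) - q (S j ((S j ^^ k) x))
      + q (S j (S i ((S j ^^ k) x))) = 0"
    using defect[OF assms, of "(S j ^^ k) x"] commute[OF assms(1,2)] by simp
  moreover have "S i ((S j ^^ k) x) = (S j ^^ k) (S i x)"
    using power_commute[OF assms(1,2), of 1 k x] by simp
  ultimately show ?case using Suc by simp
qed simp

lemma drop_power_invariant:
  assumes "i \<in> {1..n}" "j \<in> {1..n}" "i \<noteq> j"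
  shows "q ((S i ^^ l) x) - q ((S j ^^ k) ((S i ^^ l) x)) = q x - q ((S j ^^ k) x)"
  by (induction l) (simp_all add: drop_invariant[OF assms])

lemma drop_fold_invariant:
  assumes "set is \<subseteq> {1..n} - {j}" "j \<in> {1..n}"
  shows "q (fold (\<lambda>i. S i ^^ k) is x) - q ((S j ^^ k) (fold (\<lambda>i. S i ^^ k) is x))
    = q x - q ((S j ^^ k) x)"
  using assms(1)
proof (induction "is" arbitrary: x)
  case (Cons i "is")
  then show ?case
    using drop_power_invariant[of i j k x] assms(2) by auto
qed simp

text \<open>By invariance each drop may be measured at the point already reached by the powers of
  the earlier maps; the sum then telescopes.\<close>

lemma sum_drops:
  assumes "m \<le> n"
  shows "(\<Sum>j=1..m. q x - q ((S j ^^ k) x)) = q x - q (fold (\<lambda>i. S i ^^ k) [1..<Suc m] x)"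
  using assms
proof (induction m)
  case (Suc m)
  have "q (fold (\<lambda>i. S i ^^ k) [1..<Suc m] x) - q ((S (Suc m) ^^ k) (fold (\<lambda>i. S i ^^ k) [1..<Suc m] x))
    = q x - q ((S (Suc m) ^^ k) x)"
    using Suc.prems by (intro drop_fold_invariant) auto
  with Suc show ?case by simp
qed simp

text \<open>Commutativity regroups a product of powers into a power of the product, which is what
  purity controls.\<close>

lemma fold_power:
  assumes "m \<le> n"
  shows "fold (\<lambda>i. S i ^^ k) [1..<Suc m] x = (fold S [1..<Suc m] ^^ k) x"
  using assms
proof (induction m arbitrary: x)
  case 0
  have "((\<lambda>x. x) ^^ k) x = x" by (induction k) simp_all
  then show ?case by (simp add: id_def)
next
  case (Suc m)
  let ?R = "fold S [1..<Suc m]"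
  have comm: "S (Suc m) (fold S is x) = fold S is (S (Suc m) x)" if "set is \<subseteq> {1..n}" for "is" x
    using that Suc.prems by (induction "is" arbitrary: x) (simp_all add: commute)
  have power: "((S (Suc m) \<circ> ?R) ^^ k) x = (S (Suc m) ^^ k) ((?R ^^ k) x)" for x
  proof (induction k)
    case (Suc k)
    have "?R ((S (Suc m) ^^ k) y) = (S (Suc m) ^^ k) (?R y)" for y
      by (rule funpow_commute[symmetric], rule comm) (use \<open>Suc m \<le> n\<close> in auto)
    with Suc show ?case by (simp add: o_def del: upt_Suc)
  qed simp
  have fold_Suc: "fold f [1..<Suc (Suc m)] = f (Suc m) \<circ> fold f [1..<Suc m]"
    for f :: "nat \<Rightarrow> 'a \<Rightarrow> 'a"
    by simp
  have "fold (\<lambda>i. S i ^^ k) [1..<Suc (Suc m)] x = (S (Suc m) ^^ k) ((?R ^^ k) x)"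
    by (simp only: fold_Suc comp_apply Suc.IH[OF Suc_leD[OF Suc.prems]])
  then show ?case
    by (simp only: fold_Suc[of S] power)
qed

text \<open>The drop along \<open>S j\<close> at \<open>x\<close> equals the one at the image of \<open>x\<close> under the powers of all the
  other maps, where the value reached is that of \<open>q\<close> at a power of the full product.\<close>

lemma drop_ge:
  assumes q: "\<And>x. q x \<ge> 0" and j: "j \<in> {1..n}"
  shows "q x - q ((S j ^^ k) x) \<ge> - q ((fold S [1..<Suc n] ^^ k) x)"
proof -
  let ?F = "fold (\<lambda>i. S i ^^ k)" and ?is = "remove1 j [1..<Suc n]"
  \<comment> \<open>Commutativity lets the power of \<open>S j\<close> act first, leaving a fold
    over the other indices.\<close>
  have "?F [1..<Suc n] = ?F ?is \<circ> (S j ^^ k)"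
    using j by (intro fold_remove1_split) (auto simp: fun_eq_iff intro!: power_commute)
  moreover have "(S j ^^ k) (?F is x) = ?F is ((S j ^^ k) x)" if "set is \<subseteq> {1..n}" for "is" x
    using that j by (induction "is" arbitrary: x) (simp_all add: power_commute)
  then have "(S j ^^ k) (?F ?is x) = ?F ?is ((S j ^^ k) x)"
    using set_remove1_subset[of j "[1..<Suc n]"] by (metis atLeastLessThanSuc_atLeastAtMost set_upt)
  moreover have "q (?F ?is x) - q ((S j ^^ k) (?F ?is x)) = q x - q ((S j ^^ k) x)"
    using j by (intro drop_fold_invariant) auto
  ultimately have "q x - q ((S j ^^ k) x) = q (?F ?is x) - q ((fold S [1..<Suc n] ^^ k) x)"
    using fold_power[of n k x] by simp
  with q[of "?F ?is x"] show ?thesis by simp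
qed

end

section \<open>The decomposition\<close>

text \<open>Taking adjoints reverses the product, so the adjoint of \<open>T 1\<close> acts first,
  exactly as in a \<open>fold\<close> over the ascending list.\<close>

lemma tuple_product_cadjoint:
  fixes T :: "nat \<Rightarrow> 'a::chilbert_space \<Rightarrow>\<^sub>L 'a"
  assumes "\<And>i. i \<in> {1..n} \<Longrightarrow> complex_linear (T i)"
  shows "complex_linear (tuple_product n T) \<and>
    blinfun_apply ((tuple_product n T)\<^sup>\<star>) = fold (\<lambda>i. blinfun_apply ((T i)\<^sup>\<star>)) [1..<Suc n]"
  using assms
proof (induction n)
  case 0
  have "(id_blinfun :: 'a \<Rightarrow>\<^sub>L 'a)\<^sup>\<star> = id_blinfun"
    by (rule cadjoint_eqI) simp
  then show ?case by (simp add: complex_linear_id fun_eq_iff)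
next
  case (Suc n)
  then have "complex_linear (T (Suc n))" by simp
  with Suc show ?case
    by (simp add: complex_linear_compose cadjoint_compose fun_eq_iff)
qed

lemma blinfun_apply_power: "blinfun_apply (blinfun_power A k) = blinfun_apply A ^^ k"
  by (induction k) (simp_all add: fun_eq_iff)

theorem theorem4p4:
  fixes T :: "nat \<Rightarrow> 'a::chilbert_space \<Rightarrow>\<^sub>L 'a"
    and X :: "'a \<Rightarrow>\<^sub>L 'a"
    and n :: nat
  assumes "separable_space (euclidean :: 'a topology)"
    and "n \<ge> 2"
    and "T \<in> class_B0 n"
    and "contraction X"
    and "\<forall>i\<in>{1..n}. X o\<^sub>L T i = T i o\<^sub>L X"
  shows "\<exists>G :: nat \<Rightarrow> 'a \<Rightarrow>\<^sub>L 'a.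
           (\<forall>j\<in>{1..n}. positive_operator (G j)) \<and>
           id_blinfun - (X o\<^sub>L X\<^sup>\<star>) = (\<Sum>j=1..n. G j) \<and>
           (\<forall>i\<in>{1..n}. \<forall>j\<in>{1..n}. i \<noteq> j \<longrightarrow> G j - (T i o\<^sub>L G j o\<^sub>L (T i)\<^sup>\<star>) = 0)"
proof -

  \<comment> \<open>Relations passed on to the adjoints and to the form \<open>q\<close>\<close>
  define S where "S i = blinfun_apply ((T i)\<^sup>\<star>)" for i
  define q where "q x = (norm x)\<^sup>2 - (norm (X\<^sup>\<star> x))\<^sup>2" for x
  have T: "contraction (T i)" and T_lin: "complex_linear (T i)" if "i \<in> {1..n}" for i
    using assms(3) that by (auto simp: class_B0_def contraction_def)
  have TT: "T i o\<^sub>L T j = T j o\<^sub>L T i" if "i \<in> {1..n}" "j \<in> {1..n}" for i j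
    using assms(3) that by (auto simp: class_B0_def)
  have X: "complex_linear X"
    using assms(4) by (simp add: contraction_def)
  have SS: "S i (S j x) = S j (S i x)" if "i \<in> {1..n}" "j \<in> {1..n}" for i j x
  proof -
    have "(T j)\<^sup>\<star> o\<^sub>L (T i)\<^sup>\<star> = (T i)\<^sup>\<star> o\<^sub>L (T j)\<^sup>\<star>"
      using TT[OF that] that T_lin by (metis cadjoint_compose)
    then show ?thesis
      unfolding S_def by (metis blinfun_apply_blinfun_compose)
  qed
  have XS: "X\<^sup>\<star> (S i x) = S i (X\<^sup>\<star> x)" if "i \<in> {1..n}" for i x
  proof -
    have "(T i)\<^sup>\<star> o\<^sub>L X\<^sup>\<star> = X\<^sup>\<star> o\<^sub>L (T i)\<^sup>\<star>"
      using assms(5) that T_lin X by (metis cadjoint_compose)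
    then show ?thesis
      unfolding S_def by (metis blinfun_apply_blinfun_compose)
  qed
  have norm_defect: "(norm x)\<^sup>2 - (norm (S i x))\<^sup>2 - (norm (S j x))\<^sup>2 + (norm (S i (S j x)))\<^sup>2 = 0"
    if ij: "i \<in> {1..n}" "j \<in> {1..n}" "i \<noteq> j" for i j x
  proof -
    have "id_blinfun - (T i o\<^sub>L (T i)\<^sup>\<star>) - (T j o\<^sub>L (T j)\<^sup>\<star>)
        + (T i o\<^sub>L T j o\<^sub>L (T i)\<^sup>\<star> o\<^sub>L (T j)\<^sup>\<star>) = 0"
      using assms(3) ij by (auto simp: class_B0_def)
    then have "x - T i (S i x) - T j (S j x) + T i (T j (S i (S j x))) = 0"
      unfolding S_def
      by (metis (no_types) blinfun.add_left blinfun.diff_left blinfun_apply_blinfun_compose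
          blinfun_apply_id_blinfun id_apply zero_blinfun.rep_eq)
    then have "cinner (x - T i (S i x) - T j (S j x) + T i (T j (S i (S j x)))) x = 0"
      by simp
    \<comment> \<open>Moving \<open>T i\<close> and then \<open>T j\<close> across the inner product
      reverses their order; \<open>SS\<close> restores it afterwards.\<close>
    then have "cinner x x - cinner (S i x) (S i x) - cinner (S j x) (S j x)
        + cinner (S i (S j x)) (S j (S i x)) = 0"
      using ij by (simp add: cinner_add_left cinner_diff_left S_def cinner_cadjoint_right T_lin)
    then have "complex_of_real ((norm x)\<^sup>2 - (norm (S i x))\<^sup>2 - (norm (S j x))\<^sup>2
        + (norm (S i (S j x)))\<^sup>2) = 0"
      by (simp add: SS[OF ij(2,1)] cinner_self)
    then show ?thesis
      by (simp only: of_real_eq_0_iff)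
  qed
  interpret vanishing_defects n S q
  proof
    \<comment> \<open>Since the adjoint of \<open>X\<close> commutes with the \<open>S i\<close>,
      the defect of \<open>q\<close> is the norm defect at \<open>x\<close> minus the one at the
      image of \<open>x\<close> under that adjoint.\<close>
    show "q x - q (S i x) - q (S j x) + q (S i (S j x)) = 0"
      if "i \<in> {1..n}" "j \<in> {1..n}" "i \<noteq> j" for i j x
      using norm_defect[OF that, of x] norm_defect[OF that, of "X\<^sup>\<star> x"] that
      by (simp add: q_def XS)
  qed (rule SS)
  have q_nonneg: "q x \<ge> 0" and q_le: "q x \<le> (norm x)\<^sup>2" for x
    using norm_cadjoint_apply_le[OF assms(4), of x] by (simp_all add: q_def power_mono)
  \<comment> \<open>Strong convergence gives convergence at each vector, and \<open>q\<close> is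
    squeezed between 0 and the squared norm.\<close>
  have pure: "(\<lambda>k. q ((fold S [1..<Suc n] ^^ k) x)) \<longlonglongrightarrow> 0" for x
  proof -
    have "limitin strong_operator_topology (blinfun_power ((tuple_product n T)\<^sup>\<star>)) 0 sequentially"
      using assms(3) by (simp add: class_B0_def pure_contraction_def)
    from continuous_map_limit[OF strong_operator_topology_continuous_evaluation this, of x]
    have "(\<lambda>k. blinfun_power ((tuple_product n T)\<^sup>\<star>) k x) \<longlonglongrightarrow> 0"
      by (simp add: o_def)
    then have "(\<lambda>k. (fold S [1..<Suc n] ^^ k) x) \<longlonglongrightarrow> 0"
      using tuple_product_cadjoint[of n T] T_lin by (simp add: blinfun_apply_power S_def[abs_def] del: upt_Suc)
    then have "(\<lambda>k. (norm ((fold S [1..<Suc n] ^^ k) x))\<^sup>2) \<longlonglongrightarrow> (norm (0::'a))\<^sup>2"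
      by (intro tendsto_intros)
    then have "(\<lambda>k. (norm ((fold S [1..<Suc n] ^^ k) x))\<^sup>2) \<longlonglongrightarrow> 0"
      by simp
    then show ?thesis
      by (rule tendsto_sandwich[OF _ _ tendsto_const, rotated 2])
         (intro always_eventually allI q_nonneg q_le)+
  qed

  \<comment> \<open>Construction of the operators \<open>G j\<close>\<close>
  have "\<forall>i\<in>{1..n}. \<exists>A. complex_linear A \<and> (\<forall>x. \<exists>r. cinner (blinfun_apply A x) x = of_real r \<and>
      (\<lambda>k. (norm ((S i ^^ k) x))\<^sup>2) \<longlonglongrightarrow> r)"
    unfolding S_def
  proof (rule ballI)
    fix i assume "i \<in> {1..n}"
    from limit_norm_power_operator[OF complex_linear_cadjoint[OF T_lin[OF this]]
        norm_cadjoint_apply_le[OF T[OF this]]]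
    show "\<exists>A. complex_linear A \<and> (\<forall>x. \<exists>r. cinner (blinfun_apply A x) x = of_real r \<and>
      (\<lambda>k. (norm ((blinfun_apply ((T i)\<^sup>\<star>) ^^ k) x))\<^sup>2) \<longlonglongrightarrow> r)" .
  qed
  then obtain A where A: "\<And>i. i \<in> {1..n} \<Longrightarrow> complex_linear (A i)"
    and A_lim: "\<And>i x. i \<in> {1..n} \<Longrightarrow> \<exists>r. cinner (blinfun_apply (A i) x) x = of_real r \<and>
      (\<lambda>k. (norm ((S i ^^ k) x))\<^sup>2) \<longlonglongrightarrow> r"
    by metis
  define \<Delta> where "\<Delta> = id_blinfun - (X o\<^sub>L X\<^sup>\<star>)"
  \<comment> \<open>The form of the bracket is the limit of \<open>q\<close> along the powers of
    \<open>S j\<close>: \<open>A j\<close> accounts for the first norm in \<open>q\<close>, and its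
    compression by \<open>X\<close> for the second.\<close>
  define G where "G j = \<Delta> - (A j - (X o\<^sub>L A j o\<^sub>L X\<^sup>\<star>))" for j
  have \<Delta>_lin: "complex_linear \<Delta>"
    unfolding \<Delta>_def by (intro complex_linear_diff complex_linear_id complex_linear_compose
        complex_linear_cadjoint X)
  have G_lin: "complex_linear (G j)" if "j \<in> {1..n}" for j
    unfolding G_def by (intro complex_linear_diff complex_linear_compose
        complex_linear_cadjoint X A \<Delta>_lin that)
  have \<Delta>_q: "cinner (\<Delta> x) x = of_real (q x)" for x
    by (simp add: \<Delta>_def blinfun.diff_left cinner_diff_left X q_def cinner_self
        flip: cinner_cadjoint_right)
  have "\<exists>r. cinner (G j x) x = of_real r \<and> (\<lambda>k. q x - q ((S j ^^ k) x)) \<longlonglongrightarrow> r"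
    if j: "j \<in> {1..n}" for j x
  proof -
    obtain r r' where r: "cinner (A j x) x = of_real r" "(\<lambda>k. (norm ((S j ^^ k) x))\<^sup>2) \<longlonglongrightarrow> r"
      and r': "cinner (A j (X\<^sup>\<star> x)) (X\<^sup>\<star> x) = of_real r'"
        "(\<lambda>k. (norm ((S j ^^ k) (X\<^sup>\<star> x)))\<^sup>2) \<longlonglongrightarrow> r'"
      using A_lim[OF j] by metis
    have "(S j ^^ k) (X\<^sup>\<star> x) = X\<^sup>\<star> ((S j ^^ k) x)" for k
      by (rule funpow_commute) (simp add: XS[OF j])
    with r'(2) have "(\<lambda>k. q x - q ((S j ^^ k) x)) \<longlonglongrightarrow> q x - (r - r')"
      unfolding q_def[of "(S j ^^ _) x"] using r(2) by (intro tendsto_intros) simp_all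
    moreover have "cinner (G j x) x = of_real (q x - (r - r'))"
      using r(1) r'(1) by (simp add: G_def blinfun.diff_left cinner_diff_left \<Delta>_q
          cinner_cadjoint_right[OF X])
    ultimately show ?thesis by blast
  qed
  then obtain d where Gd: "\<And>j x. j \<in> {1..n} \<Longrightarrow> cinner (G j x) x = of_real (d j x)"
    and d: "\<And>j x. j \<in> {1..n} \<Longrightarrow> (\<lambda>k. q x - q ((S j ^^ k) x)) \<longlonglongrightarrow> d j x"
    by metis

  \<comment> \<open>Positivity, sum and invariance\<close>
  have "d j x \<ge> 0" if j: "j \<in> {1..n}" for j x
  proof -
    \<comment> \<open>The lower bound that \<open>drop_ge\<close> gives for each drop tends to 0 by
      purity.\<close>
    have "(\<lambda>k. - q ((fold S [1..<Suc n] ^^ k) x)) \<longlonglongrightarrow> - 0"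
      by (intro tendsto_intros pure)
    then have "- 0 \<le> d j x"
      using drop_ge[OF q_nonneg j] by (intro LIMSEQ_le[OF _ d[OF j]]) auto
    then show ?thesis by simp
  qed
  then have "positive_operator (G j)" if "j \<in> {1..n}" for j
    using that by (simp add: positive_operator_def G_lin Gd)
  moreover have "\<Delta> = (\<Sum>j=1..n. G j)"
  proof (rule complex_linear_eqI[OF \<Delta>_lin complex_linear_sum])
    fix x
    have "(\<lambda>k. \<Sum>j=1..n. q x - q ((S j ^^ k) x)) \<longlonglongrightarrow> (\<Sum>j=1..n. d j x)"
      by (intro tendsto_sum d)
    \<comment> \<open>The drops add up to the drop along the power of the full product, whose
      remainder vanishes in the limit.\<close>
    moreover have "(\<lambda>k. \<Sum>j=1..n. q x - q ((S j ^^ k) x)) \<longlonglongrightarrow> q x - 0"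
      unfolding sum_drops[OF order_refl] fold_power[OF order_refl]
      by (intro tendsto_intros pure)
    ultimately have "q x = (\<Sum>j=1..n. d j x)"
      using LIMSEQ_unique by fastforce
    then show "cinner (\<Delta> x) x = cinner ((\<Sum>j=1..n. G j) x) x"
      by (simp add: \<Delta>_q blinfun.sum_left cinner_sum_left Gd)
  qed (rule G_lin)
  moreover have "G j - (T i o\<^sub>L G j o\<^sub>L (T i)\<^sup>\<star>) = 0"
    if ij: "i \<in> {1..n}" "j \<in> {1..n}" "i \<noteq> j" for i j
  proof -
    \<comment> \<open>The drops at \<open>S i x\<close> and at \<open>x\<close> agree for every
      \<open>k\<close>, hence so do their limits; \<open>d j (S i x)\<close> is the form of the
      conjugated operator at \<open>x\<close>.\<close>
    have "d j (S i x) = d j x" for x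
      using d[OF ij(2), of "S i x"] d[OF ij(2), of x]
      by (auto simp: drop_invariant[OF ij] intro: LIMSEQ_unique)
    then have "cinner (G j x) x = cinner ((T i o\<^sub>L G j o\<^sub>L (T i)\<^sup>\<star>) x) x" for x
      using Gd[OF ij(2), of "S i x"] ij
      by (simp add: Gd S_def flip: cinner_cadjoint_right[OF T_lin])
    then have "G j = T i o\<^sub>L G j o\<^sub>L (T i)\<^sup>\<star>"
      by (intro complex_linear_eqI complex_linear_compose complex_linear_cadjoint G_lin T_lin ij)
    then show ?thesis by simp
  qed
  ultimately show ?thesis
    unfolding \<Delta>_def by blast
qed

end
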